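(* Let $X,Y$ be metric spaces with $X$ complete, $F:X\times\mathbb{R}_+\rightrightarrows Y$ a set-valued mapping, $(\bar x,\bar y)\in\operatorname{gph}F_0$, and $\mu:[0,+\infty]\to[0,+\infty]$ a continuous nondecreasing function with $\mu(\tau)=0$ if and only if $\tau=0$. Suppose that there exist neighbourhoods $U$ of $\bar x$ and $V$ of $\bar y$ such that $F^{-1}$ takes closed values on $V$ and, for any $x\in U$, $y\in V$ and $u\in U_{x,y}$, there exists a point $u'\ne u$ in $X$ such that $$\mu(\delta(y,F,u'))\le\mu(\delta(y,F,u))-d(u,u').$$ Then $F$ is regular at $(\bar x,\bar y)$ with functional modulus $\mu$, i.e. there exist neighbourhoods $U'$ of $\bar x$ and $V'$ of $\bar y$ such that $d(x,F_0^{-1}(y))\le\mu(\delta(y,F,x))$ for all $x\in U'$, $y\in V'$.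
   Context: $\mathbb{R}_+=[0,\infty)$. $d(x,C)=\inf_{c\in C}d(x,c)$, with $d(x,\emptyset)=+\infty$. Set-valued mappings have possibly empty values; $\operatorname{gph}F_0=\{(x,y)\mid y\in F(x,0)\}$, $F^{-1}(y)=\{(x,t)\in X\times\mathbb{R}_+\mid y\in F(x,t)\}$ (closedness is in $X\times\mathbb{R}_+$), $F_0^{-1}(y)=\{x\in X\mid y\in F(x,0)\}$, $\delta(y,F,x):=\inf\{t>0\mid y\in F(x,t)\}$ (with $\inf\emptyset=+\infty$). For $(x,y)\in X\times Y$, $$U_{x,y}:=\{u\in X\mid\delta(y,F,u)>0,\ \mu(\delta(y,F,u))+d(u,x)\le\mu(\delta(y,F,x))\}.$$ *)

theory Defs
  imports "HOL-Analysis.Analysis"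
begin

text \<open>
  A set-valued mapping from X times the nonnegative reals to Y is a function
  \<open>F :: 'a \<times> real \<Rightarrow> 'b set\<close>. Its values at negative second arguments are
  never consulted by the definitions below.
\<close>

definition gph0 :: "('a \<times> real \<Rightarrow> 'b set) \<Rightarrow> ('a \<times> 'b) set" where
  "gph0 F = {(x, y). y \<in> F (x, 0)}"

definition inv_map :: "('a \<times> real \<Rightarrow> 'b set) \<Rightarrow> 'b \<Rightarrow> ('a \<times> real) set" where
  "inv_map F y = {(x, t). 0 \<le> t \<and> y \<in> F (x, t)}"

definition inv_map0 :: "('a \<times> real \<Rightarrow> 'b set) \<Rightarrow> 'b \<Rightarrow> 'a set" where
  "inv_map0 F y = {x. y \<in> F (x, 0)}"

text \<open>Unlike \<^const>\<open>infdist\<close>, which is 0 on the empty set, this distance to the empty set is infinite.\<close>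

definition dist_set :: "'a::metric_space \<Rightarrow> 'a set \<Rightarrow> ennreal" where
  "dist_set x C = (INF c\<in>C. ennreal (dist x c))"

text \<open>The infimum is taken in \<^typ>\<open>ennreal\<close>, so it is infinite when there is no such \<open>t\<close>.\<close>

definition delta :: "'b \<Rightarrow> ('a \<times> real \<Rightarrow> 'b set) \<Rightarrow> 'a \<Rightarrow> ennreal" where
  "delta y F x = Inf {ennreal t | t. 0 < t \<and> y \<in> F (x, t)}"

definition U_set ::
  "('a::metric_space \<times> real \<Rightarrow> 'b set) \<Rightarrow> (ennreal \<Rightarrow> ennreal) \<Rightarrow> 'a \<Rightarrow> 'b \<Rightarrow> 'a set" where
  "U_set F \<mu> x y =
     {u. delta y F u > 0 \<and> \<mu> (delta y F u) + ennreal (dist u x) \<le> \<mu> (delta y F x)}"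

definition regular_at ::
  "('a::metric_space \<times> real \<Rightarrow> 'b::metric_space set) \<Rightarrow> (ennreal \<Rightarrow> ennreal) \<Rightarrow> 'a \<Rightarrow> 'b \<Rightarrow> bool"
where
  "regular_at F \<mu> xb yb \<longleftrightarrow>
     (\<exists>U V. xb \<in> interior U \<and> yb \<in> interior V \<and>
        (\<forall>x\<in>U. \<forall>y\<in>V. dist_set x (inv_map0 F y) \<le> \<mu> (delta y F x)))"

end

theory Submission
  imports Defs
begin

text \<open>
  The estimate holds at every \<open>x \<in> U\<close> and \<open>y \<in> V\<close>, so no neighbourhood has to shrink. Write
  \<open>\<phi> u\<close> for \<open>\<mu> (\<delta>(y, F, u))\<close>; only the case \<open>\<phi> x < \<infinity>\<close> is of interest. The idea is that of
  Ekeland's variational principle: starting from \<open>x\<close>, descend greedily along the relation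
  \<open>\<phi> v + d(u, v) \<le> \<phi> u\<close>, which gives a Cauchy sequence with a limit \<open>l\<close> such that any common
  descendant \<open>v\<close> of its terms satisfies \<open>lim \<phi>(s n) \<le> \<phi> v\<close> (\<open>ekeland_sequence\<close>).
  If \<open>\<phi>\<close> were lower semicontinuous, \<open>l\<close> would be such a common descendant, hence it would have
  no descendant but itself, and the hypothesis on \<open>U_set\<close> would force \<open>\<delta>(y, F, l) = 0\<close>.

  However, \<open>\<phi>\<close> need not be lower semicontinuous: \<open>\<delta>\<close> only looks at positive \<open>t\<close>, so
  \<open>\<delta>(y, F, s n)\<close> can tend to 0 while \<open>\<delta>(y, F, l)\<close> is positive. This failure is harmless, because
  closedness of \<open>F\<^sup>-\<^sup>1(y)\<close> then puts the limit \<open>(l, 0)\<close> into it (\<open>delta_limit_attained\<close>), that is,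
  \<open>l\<close> already lies in the target set. In each case one gets a point of the target set within
  distance \<open>\<phi> x\<close> of \<open>x\<close>.

  Although \<open>\<mu>\<close> may be constant on intervals, \<open>\<delta>(y, F, s n)\<close> converges in \<open>[0, \<infinity>]\<close>: a step of the
  descent either stays in place or strictly decreases \<open>\<phi>\<close>, hence also \<open>\<delta>\<close>. Continuity of \<open>\<mu>\<close> relates
  its limit to that of \<open>\<phi>(s n)\<close>.
\<close>

section \<open>Greedy descent in complete metric spaces\<close>

text \<open>
  The term after \<open>s n\<close> is a descendant of \<open>s n\<close> whose value exceeds the infimum
  over all descendants by less than \<open>1 / (n + 1)\<close>. The set \<open>A\<close> allows for functions that are finite
  only on a part of the space, and since the limit of the sequence may leave \<open>A\<close> if \<open>f\<close> is not
  lower semicontinuous, minimality is expressed through common descendants of the sequence.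
\<close>

lemma ekeland_sequence:
  fixes f :: "'a::complete_space \<Rightarrow> real"
  assumes "x \<in> A" and nonneg: "\<And>u. u \<in> A \<Longrightarrow> 0 \<le> f u"
  obtains s l m where
    "s 0 = x" "\<And>n. s n \<in> A" "s \<longlonglongrightarrow> l" "(\<lambda>n. f (s n)) \<longlonglongrightarrow> m"
    "\<And>n k. n \<le> k \<Longrightarrow> f (s k) + dist (s n) (s k) \<le> f (s n)"
    "\<And>v. v \<in> A \<Longrightarrow> (\<And>n. f v + dist (s n) v \<le> f (s n)) \<Longrightarrow> m \<le> f v"
proof -
  define D where "D u = {v\<in>A. f v + dist u v \<le> f u}" for u
  have bdd: "bdd_below (f ` D u)" for u
    by (rule bdd_belowI[of _ 0]) (auto simp: D_def nonneg)
  have step: "\<exists>v. v \<in> A \<and> v \<in> D u \<and> f v < Inf (f ` D u) + 1 / real (Suc n)" if "u \<in> A" for u n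
  proof -
    have "f ` D u \<noteq> {}"
      using that by (auto simp: D_def)
    then obtain v where "v \<in> D u" "f v < Inf (f ` D u) + 1 / real (Suc n)"
      using cInf_lessD[of "f ` D u" "Inf (f ` D u) + 1 / real (Suc n)"] by auto
    then show ?thesis
      by (auto simp: D_def)
  qed
  obtain s where s0: "s 0 = x" and sA: "\<And>n. s n \<in> A"
    and sD: "\<And>n. s (Suc n) \<in> D (s n)"
    and sI: "\<And>n. f (s (Suc n)) < Inf (f ` D (s n)) + 1 / real (Suc n)"
  proof -
    have "\<exists>s. \<forall>n. (s n \<in> A \<and> (n = 0 \<longrightarrow> s n = x)) \<and>
        (s (Suc n) \<in> D (s n) \<and> f (s (Suc n)) < Inf (f ` D (s n)) + 1 / real (Suc n))"
      by (rule dependent_nat_choice) (use \<open>x \<in> A\<close> step in auto)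
    then show thesis
      using that by blast
  qed
  have descent: "f (s k) + dist (s n) (s k) \<le> f (s n)" if "n \<le> k" for n k
    using that
  proof (induction k rule: dec_induct)
    case base
    then show ?case by simp
  next
    case (step k)
    then show ?case
      using sD[of k] dist_triangle[of "s n" "s (Suc k)" "s k"] by (auto simp: D_def)
  qed
  have "decseq (\<lambda>n. f (s n))"
    unfolding decseq_def using descent by (smt (verit) zero_le_dist)
  then obtain m where m: "(\<lambda>n. f (s n)) \<longlonglongrightarrow> m"
    using decseq_convergent[of "\<lambda>n. f (s n)" 0] nonneg sA by metis
  have "Cauchy s"
  proof (rule CauchyI')
    fix e :: real assume "0 < e"
    then obtain N where N: "\<And>i j. i \<ge> N \<Longrightarrow> j \<ge> N \<Longrightarrow> dist (f (s i)) (f (s j)) < e"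
      using LIMSEQ_imp_Cauchy[OF m] unfolding Cauchy_def by meson
    have "dist (s i) (s j) < e" if "i \<ge> N" "j > i" for i j
      using N[of i j] descent[of i j] that by (auto simp: dist_real_def)
    then show "\<exists>N. \<forall>i\<ge>N. \<forall>j>i. dist (s i) (s j) < e"
      by blast
  qed
  then obtain l where l: "s \<longlonglongrightarrow> l"
    using Cauchy_convergent convergent_def by blast
  have minimal: "m \<le> f v" if "v \<in> A" "\<And>n. f v + dist (s n) v \<le> f (s n)" for v
  proof (rule LIMSEQ_le)
    show "(\<lambda>n. f (s (Suc n))) \<longlonglongrightarrow> m"
      using LIMSEQ_Suc[OF m] .
    show "(\<lambda>n. f v + 1 / real (Suc n)) \<longlonglongrightarrow> f v"
      using tendsto_add[OF tendsto_const[of "f v"] lim_inverse_n'[THEN LIMSEQ_Suc]] by simp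
    have "Inf (f ` D (s n)) \<le> f v" for n
      using bdd that by (intro cInf_lower) (auto simp: D_def)
    then have "f (s (Suc n)) \<le> f v + 1 / real (Suc n)" for n
      using sI[of n] by (meson add_right_mono less_imp_le order_trans)
    then show "\<exists>N. \<forall>n\<ge>N. f (s (Suc n)) \<le> f v + 1 / real (Suc n)"
      by blast
  qed
  show thesis
    using that[OF s0 sA l m descent minimal] .
qed

section \<open>Limits of delta along sequences\<close>

text \<open>
  The substitute for lower semicontinuity of \<open>\<delta>\<close>: the parameters \<open>t n\<close> that nearly attain
  \<open>\<delta>(y, F, s n)\<close> also converge to the limit, so that closedness of \<open>F\<^sup>-\<^sup>1(y)\<close> applies to the
  points \<open>(s n, t n)\<close>.
\<close>

lemma delta_limit_attained:
  fixes F :: "'a::metric_space \<times> real \<Rightarrow> 'b::metric_space set"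
  assumes cl: "closed (inv_map F y)"
    and s: "s \<longlonglongrightarrow> l" and lim: "(\<lambda>n. delta y F (s n)) \<longlonglongrightarrow> ennreal r" and "0 \<le> r"
  shows "y \<in> F (l, r)"
proof -
  have "\<forall>\<^sub>F n in sequentially. delta y F (s n) < top"
    using lim by (rule order_tendstoD) simp
  then obtain N where N: "\<And>n. n \<ge> N \<Longrightarrow> delta y F (s n) < top"
    by (auto simp: eventually_sequentially)
  have "\<exists>t>0. y \<in> F (s (n + N), t) \<and> ennreal t < delta y F (s (n + N)) + ennreal (1 / real (Suc n))" for n
  proof -
    have "delta y F (s (n + N)) < delta y F (s (n + N)) + ennreal (1 / real (Suc n))"
      using N[of "n + N"] by (cases "delta y F (s (n + N))") (auto simp flip: ennreal_plus intro!: ennreal_lessI add_nonneg_pos)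
    then show ?thesis
      unfolding delta_def by (subst (asm) Inf_less_iff) auto
  qed
  then obtain t where t: "\<And>n. t n > 0" "\<And>n. y \<in> F (s (n + N), t n)"
    "\<And>n. ennreal (t n) < delta y F (s (n + N)) + ennreal (1 / real (Suc n))"
    by metis
  have limN: "(\<lambda>n. delta y F (s (n + N))) \<longlonglongrightarrow> ennreal r"
    using LIMSEQ_ignore_initial_segment[OF lim] .
  have "(\<lambda>n. ennreal (1 / real (Suc n))) \<longlonglongrightarrow> ennreal 0"
    by (intro tendsto_ennrealI lim_inverse_n'[THEN LIMSEQ_Suc])
  then have upper: "(\<lambda>n. delta y F (s (n + N)) + ennreal (1 / real (Suc n))) \<longlonglongrightarrow> ennreal r"
    using tendsto_add[OF limN] by force
  have "(\<lambda>n. ennreal (t n)) \<longlonglongrightarrow> ennreal r"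
  proof (rule tendsto_sandwich[OF _ _ limN upper])
    show "\<forall>\<^sub>F n in sequentially. delta y F (s (n + N)) \<le> ennreal (t n)"
      unfolding delta_def using t(1,2) by (intro always_eventually allI Inf_lower) blast
    show "\<forall>\<^sub>F n in sequentially. ennreal (t n) \<le> delta y F (s (n + N)) + ennreal (1 / real (Suc n))"
      using t(3) by (intro always_eventually allI less_imp_le)
  qed
  then have "t \<longlonglongrightarrow> r"
    using t(1) \<open>0 \<le> r\<close> by (subst (asm) tendsto_ennreal_iff) (auto intro!: always_eventually less_imp_le)
  then have "(\<lambda>n. (s (n + N), t n)) \<longlonglongrightarrow> (l, r)"
    using LIMSEQ_ignore_initial_segment[OF s] by (intro tendsto_Pair)
  moreover have "(s (n + N), t n) \<in> inv_map F y" for n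
    using t(1,2)[of n] by (auto simp: inv_map_def)
  ultimately have "(l, r) \<in> inv_map F y"
    using closed_sequentially[OF cl, of "\<lambda>n. (s (n + N), t n)"] by blast
  then show ?thesis
    by (simp add: inv_map_def)
qed

lemma delta_zero_imp_inv_map0:
  fixes F :: "'a::metric_space \<times> real \<Rightarrow> 'b::metric_space set"
  assumes "closed (inv_map F y)" and "delta y F u = 0"
  shows "u \<in> inv_map0 F y"
  using delta_limit_attained[of F y "\<lambda>_. u" u 0] assms by (simp add: inv_map0_def)

section \<open>The distance estimate\<close>

text \<open>
  The estimate at a single pair \<open>(x, y)\<close>. The greedy sequence from \<open>x\<close> converges to a point of the
  target set: otherwise its limit would be a common descendant of its terms that lies in \<open>U_set\<close>, and
  the next descent step from there would get below the greedy minimum. Distances being finite,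
  the descent condition can be stated without subtraction.
\<close>

lemma dist_set_inv_map0_le:
  fixes F :: "'a::complete_space \<times> real \<Rightarrow> 'b::metric_space set"
  assumes cont: "continuous_on UNIV \<mu>" and mono: "mono \<mu>"
    and cl: "closed (inv_map F y)"
    and finite: "\<mu> (delta y F x) < top"
    and descent: "\<And>u. u \<in> U_set F \<mu> x y \<Longrightarrow>
      \<exists>u'. u' \<noteq> u \<and> \<mu> (delta y F u') + ennreal (dist u u') \<le> \<mu> (delta y F u)"
  shows "dist_set x (inv_map0 F y) \<le> \<mu> (delta y F x)"
proof -
  define \<phi> where "\<phi> u = \<mu> (delta y F u)" for u
  define A where "A = {u. \<phi> u < top}"
  define f where "f u = enn2real (\<phi> u)" for u
  have \<phi>_eq: "\<phi> u = ennreal (f u)" if "u \<in> A" for u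
    using that by (simp add: A_def f_def)
  have f_nonneg: "0 \<le> f u" for u
    by (simp add: f_def)
  have xA: "x \<in> A"
    using finite by (simp add: A_def \<phi>_def)
  obtain s l m where s0: "s 0 = x" and sA: "\<And>n. s n \<in> A" and sl: "s \<longlonglongrightarrow> l"
    and fm: "(\<lambda>n. f (s n)) \<longlonglongrightarrow> m"
    and desc: "\<And>n k. n \<le> k \<Longrightarrow> f (s k) + dist (s n) (s k) \<le> f (s n)"
    and minimal: "\<And>v. v \<in> A \<Longrightarrow> (\<And>n. f v + dist (s n) v \<le> f (s n)) \<Longrightarrow> m \<le> f v"
    using ekeland_sequence[OF xA, of f] f_nonneg by metis
  have m0: "0 \<le> m"
    by (rule LIMSEQ_le_const[OF fm]) (use f_nonneg in blast)
  have limit_desc: "m + dist (s n) l \<le> f (s n)" for n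
  proof (rule LIMSEQ_le_const2)
    show "(\<lambda>k. f (s k) + dist (s n) (s k)) \<longlonglongrightarrow> m + dist (s n) l"
      by (intro tendsto_intros fm sl)
  qed (use desc in blast)
  have "l \<in> inv_map0 F y"
  proof -
    have "delta y F (s (Suc n)) \<le> delta y F (s n)" for n
    proof (rule ccontr)
      assume less: "\<not> ?thesis"
      then have "\<phi> (s n) \<le> \<phi> (s (Suc n))"
        unfolding \<phi>_def by (intro monoD[OF mono]) simp
      then have "f (s n) \<le> f (s (Suc n))"
        using sA f_nonneg by (simp add: \<phi>_eq)
      then have "dist (s n) (s (Suc n)) \<le> 0"
        using desc[of n "Suc n"] by linarith
      then have "s (Suc n) = s n"
        by simp
      then show False
        using less by simp
    qed
    then have "decseq (\<lambda>n. delta y F (s n))"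
      by (rule decseq_SucI)
    then obtain L where L: "(\<lambda>n. delta y F (s n)) \<longlonglongrightarrow> L"
      by (rule that[OF LIMSEQ_INF])
    have "(\<lambda>n. \<phi> (s n)) \<longlonglongrightarrow> \<mu> L"
      unfolding \<phi>_def using continuous_on_tendsto_compose[OF cont L] by simp
    moreover have "(\<lambda>n. \<phi> (s n)) \<longlonglongrightarrow> ennreal m"
      using tendsto_ennrealI[OF fm] \<phi>_eq sA by simp
    ultimately have \<mu>L: "\<mu> L = ennreal m"
      using LIMSEQ_unique by blast
    have attained: "y \<in> F (l, enn2real L)" if "L < top"
      using delta_limit_attained[OF cl sl, of "enn2real L"] L that by simp
    show ?thesis
    proof (cases "L = 0 \<or> delta y F l = 0")
      case True
      \<comment> \<open>\<open>L = 0\<close> is the case in which lower semicontinuity may fail at \<open>l\<close>.\<close>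
      then show ?thesis
        using attained delta_zero_imp_inv_map0[OF cl] by (auto simp: inv_map0_def)
    next
      case False
      have "delta y F l \<le> L"
      proof (cases "L < top")
        case True
        then have "L = ennreal (enn2real L)" "0 < enn2real L"
          using False by (auto simp: enn2real_positive_iff zero_less_iff_neq_zero)
        then show ?thesis
          unfolding delta_def using attained[OF True] by (intro Inf_lower) blast
      qed (simp flip: less_top)
      then have \<phi>l: "\<phi> l \<le> ennreal m"
        unfolding \<phi>_def \<mu>L[symmetric] using mono by (rule monoD[rotated])
      then have lA: "l \<in> A"
        by (auto simp: A_def intro: le_less_trans)
      then have fl: "f l \<le> m"
        using \<phi>l m0 by (simp add: \<phi>_eq)
      have "l \<in> U_set F \<mu> x y"
      proof -
        have "f l + dist l x \<le> f x"
          using limit_desc[of 0] fl s0 by (simp add: dist_commute)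
        then have "\<phi> l + ennreal (dist l x) \<le> \<phi> x"
          using lA xA f_nonneg by (simp add: \<phi>_eq flip: ennreal_plus)
        then show ?thesis
          using False by (simp add: U_set_def \<phi>_def zero_less_iff_neq_zero)
      qed
      then obtain v where "v \<noteq> l" and v: "\<phi> v + ennreal (dist l v) \<le> \<phi> l"
        using descent unfolding \<phi>_def by blast
      have vA: "v \<in> A"
      proof -
        have "\<phi> v \<le> \<phi> l"
          using v by (meson le_add_same_cancel1 order_trans zero_le le_iff_add)
        then show ?thesis
          using lA by (auto simp: A_def)
      qed
      have fv: "f v + dist l v \<le> f l"
        using v lA vA f_nonneg by (simp add: \<phi>_eq flip: ennreal_plus)
      have "m \<le> f v"
      proof (rule minimal[OF vA])
        show "f v + dist (s n) v \<le> f (s n)" for n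
          using fv fl limit_desc[of n] dist_triangle[of "s n" v l] by linarith
      qed
      then have "dist l v \<le> 0"
        using fv fl by linarith
      then show ?thesis
        using \<open>v \<noteq> l\<close> by simp
    qed
  qed
  then have "dist_set x (inv_map0 F y) \<le> ennreal (dist x l)"
    unfolding dist_set_def by (rule INF_lower)
  also have "\<dots> \<le> ennreal (f x)"
    using limit_desc[of 0] m0 s0 by (intro ennreal_leI) simp
  finally show ?thesis
    using \<phi>_eq[OF xA] by (simp add: \<phi>_def)
qed

lemma ennreal_add_le_of_ereal_le_diff:
  assumes "enn2ereal a \<le> enn2ereal b - ereal c" and "0 \<le> c"
  shows "a + ennreal c \<le> b"
proof -
  have "enn2ereal a + ereal c \<le> enn2ereal b"
    using assms(1) by (subst (asm) ereal_le_minus) auto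
  then show ?thesis
    using assms(2) by (simp add: less_eq_ennreal.rep_eq plus_ennreal.rep_eq enn2ereal_ennreal)
qed

theorem theorem3p15:
  fixes F :: "'a::complete_space \<times> real \<Rightarrow> 'b::metric_space set"
    and \<mu> :: "ennreal \<Rightarrow> ennreal"
    and xb :: 'a and yb :: 'b
  assumes "(xb, yb) \<in> gph0 F"
    and "continuous_on UNIV \<mu>"
    and "mono \<mu>"
    and "\<And>\<tau>. \<mu> \<tau> = 0 \<longleftrightarrow> \<tau> = 0"
    and "\<exists>U V. xb \<in> interior U \<and> yb \<in> interior V \<and>
           (\<forall>y\<in>V. closedin (top_of_set (UNIV \<times> {0..})) (inv_map F y)) \<and>
           (\<forall>x\<in>U. \<forall>y\<in>V. \<forall>u\<in>U_set F \<mu> x y. \<exists>u'. u' \<noteq> u \<and>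
              enn2ereal (\<mu> (delta y F u')) \<le> enn2ereal (\<mu> (delta y F u)) - ereal (dist u u'))"
  shows "regular_at F \<mu> xb yb"
proof -
  obtain U V where nhds: "xb \<in> interior U" "yb \<in> interior V"
    and closedin: "\<And>y. y \<in> V \<Longrightarrow> closedin (top_of_set (UNIV \<times> {0..})) (inv_map F y)"
    and descent: "\<And>x y u. x \<in> U \<Longrightarrow> y \<in> V \<Longrightarrow> u \<in> U_set F \<mu> x y \<Longrightarrow> \<exists>u'. u' \<noteq> u \<and>
        enn2ereal (\<mu> (delta y F u')) \<le> enn2ereal (\<mu> (delta y F u)) - ereal (dist u u')"
    using assms(5) by blast
  have "dist_set x (inv_map0 F y) \<le> \<mu> (delta y F x)" if "x \<in> U" "y \<in> V" for x y
  proof (cases "\<mu> (delta y F x) < top")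
    case True
    have "closed (inv_map F y)"
      using closedin_closed_trans[OF closedin[OF \<open>y \<in> V\<close>]] by (simp add: closed_Times)
    then show ?thesis
    proof (rule dist_set_inv_map0_le[OF assms(2,3) _ True])
      fix u assume "u \<in> U_set F \<mu> x y"
      then show "\<exists>u'. u' \<noteq> u \<and> \<mu> (delta y F u') + ennreal (dist u u') \<le> \<mu> (delta y F u)"
        using descent[OF that] ennreal_add_le_of_ereal_le_diff zero_le_dist by meson
    qed
  qed (simp flip: less_top)
  then show ?thesis
    unfolding regular_at_def using nhds by blast
qed

end
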